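(* (i) For every finite alphabet $\Sigma$, every language of infinite pictures $L \subseteq \Sigma^{\omega,\omega}$ which is accepted row by row by an ordinal Büchi automaton is Büchi-recognized by some finite tiling system. (ii) The converse is not true: there exist a finite alphabet $\Sigma$ and a language of infinite pictures $L \subseteq \Sigma^{\omega,\omega}$ which is Büchi-recognized by a finite tiling system but is not accepted row by row by any ordinal Büchi automaton.
   Context: Pictures. Let $\Sigma$ be a finite alphabet, $\#\notin\Sigma$ a border letter, and $\hat{\Sigma}=\Sigma\cup\{\#\}$. An $\omega$-picture (infinite picture) over $\Sigma$ is a function $p:\omega\times\omega\to\hat{\Sigma}$ such that $p(i,0)=p(0,i)=\#$ for all $i\ge 0$ and $p(i,j)\in\Sigma$ for all $i,j>0$. $\Sigma^{\omega,\omega}$ is the set of all $\omega$-pictures over $\Sigma$; a language of infinite pictures is a subset of $\Sigma^{\omega,\omega}$. Tiling systems. A (finite) tiling system is a tuple $\mathcal{A}=(Q,\Sigma,\Delta)$ with $Q$ a finite set of states, $\Sigma$ a finite alphabet, and $\Delta\subseteq(\hat{\Sigma}\times Q)^4$ a finite set of tiles, written $\left(\begin{array}{cc}(a_3,q_3)&(a_4,q_4)\\(a_1,q_1)&(a_2,q_2)\end{array}\right)$. A run of $\mathcal{A}$ on $p\in\Sigma^{\omega,\omega}$ is a map $\rho:\omega\times\omega\to Q$ such that for all $(i,j)\in\omega\times\omega$ the tile $$\left(\begin{array}{cc}(p(i,j+1),\rho(i,j+1))&(p(i+1,j+1),\rho(i+1,j+1))\\(p(i,j),\rho(i,j))&(p(i+1,j),\rho(i+1,j))\end{array}\right)$$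 belongs to $\Delta$. For $F\subseteq Q$, the language Büchi-recognized by $(\mathcal{A},F)$ is the set of $p\in\Sigma^{\omega,\omega}$ for which there is a run $\rho$ of $\mathcal{A}$ on $p$ with $\rho(v)\in F$ for infinitely many $v\in\omega\times\omega$. Ordinal Büchi automata. An ordinal Büchi automaton is $\mathcal{B}=(\Sigma,Q,q_0,\Delta,\gamma,F)$ with $\Sigma$ a finite alphabet, $Q$ a finite set of states, $q_0\in Q$ the initial state, $\Delta\subseteq Q\times\Sigma\times Q$ the transition relation, $\gamma\subseteq P(Q)\times Q$ the transition relation for limit steps, and $F\subseteq Q$ the set of final states. A run on a word $\sigma\in\Sigma^{\alpha}$ ($\alpha$ a countable ordinal) is an $(\alpha+1)$-sequence $x$ of states with $x(0)=q_0$, $(x(i),\sigma(i),x(i+1))\in\Delta$ for all $i<\alpha$, and $(\mathrm{Inf}(x,i),x(i))\in\gamma$ for every limit ordinal $i\le\alpha$, where $\mathrm{Inf}(x,i)=\{q\in Q\mid\forall\mu<i\ \exists\nu<i\ (\mu<\nu\text{ and }x(\nu)=q)\}$. The run is successful if $x(\alpha)\in F$; $\sigma$ is accepted if there is a successful run on $\sigma$. An $\omega^2$-language (subset of $\Sigma^{\omega^2}$) is regular if it is the set of words of length $\omega^2$ accepted by some ordinal Büchi automaton. Row-by-row acceptance. To $p\in\Sigma^{\omega,\omega}$ associate the $\omega^2$-word $\bar p\in\Sigma^{\omega^2}$ given by $\bar p(\omega\cdot n+m)=p(m+1,n+1)$ for all integers $n,m\ge 0$, and put $\bar L=\{\bar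 p\mid p\in L\}$. The language $L\subseteq\Sigma^{\omega,\omega}$ is accepted row by row by an ordinal Büchi automaton if and only if $\bar L$ is a regular $\omega^2$-language. *)

theory Defs
  imports Main "HOL-Library.FuncSet" "HOL-Library.Countable" "HOL-Library.Product_Lexorder"
begin

section \<open>Infinite pictures\<close>

text \<open>The border letter \<open>#\<close> is \<^term>\<open>None\<close>; a letter \<open>a\<close> of the alphabet appears
  in a picture as \<^term>\<open>Some a\<close>. Hence \<open>#\<close> never belongs to the alphabet.\<close>

type_synonym 'a picture = "nat \<times> nat \<Rightarrow> 'a option"

definition bordered :: "'a set \<Rightarrow> 'a option set" where
  "bordered \<Sigma> = insert None (Some ` \<Sigma>)"

definition pictures :: "'a set \<Rightarrow> 'a picture set" where
  "pictures \<Sigma> = {p. (\<forall>i. p (i, 0) = None \<and> p (0, i) = None) \<and>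
                     (\<forall>i j. 0 < i \<longrightarrow> 0 < j \<longrightarrow> p (i, j) \<in> Some ` \<Sigma>)}"


section \<open>Tiling systems\<close>

text \<open>A tile is listed in the order \<open>(a\<^sub>1,q\<^sub>1), (a\<^sub>2,q\<^sub>2), (a\<^sub>3,q\<^sub>3), (a\<^sub>4,q\<^sub>4)\<close>:
  lower left, lower right, upper left, upper right.\<close>

type_synonym ('a, 'q) cell = "'a option \<times> 'q"
type_synonym ('a, 'q) tile = "('a, 'q) cell \<times> ('a, 'q) cell \<times> ('a, 'q) cell \<times> ('a, 'q) cell"

record ('a, 'q) tiling_system =
  ts_states :: "'q set"
  ts_alphabet :: "'a set"
  ts_tiles :: "('a, 'q) tile set"

definition tiling_system :: "('a, 'q) tiling_system \<Rightarrow> bool" where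
  "tiling_system A \<longleftrightarrow> finite (ts_states A) \<and> finite (ts_alphabet A) \<and>
     (let C = bordered (ts_alphabet A) \<times> ts_states A in ts_tiles A \<subseteq> C \<times> C \<times> C \<times> C)"

definition ts_run :: "('a, 'q) tiling_system \<Rightarrow> 'a picture \<Rightarrow> (nat \<times> nat \<Rightarrow> 'q) \<Rightarrow> bool" where
  "ts_run A p \<rho> \<longleftrightarrow> range \<rho> \<subseteq> ts_states A \<and>
     (\<forall>i j. ((p (i, j), \<rho> (i, j)),
             (p (i + 1, j), \<rho> (i + 1, j)),
             (p (i, j + 1), \<rho> (i, j + 1)),
             (p (i + 1, j + 1), \<rho> (i + 1, j + 1))) \<in> ts_tiles A)"

definition ts_buchi_language :: "('a, 'q) tiling_system \<Rightarrow> 'q set \<Rightarrow> 'a picture set" where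
  "ts_buchi_language A F =
     {p \<in> pictures (ts_alphabet A). \<exists>\<rho>. ts_run A p \<rho> \<and> infinite {v. \<rho> v \<in> F}}"

text \<open>State sets are finite sets of natural numbers, which up to renaming of states
  covers all finite state sets. The same convention is used for ordinal automata below.\<close>

definition buchi_recognizable :: "'a set \<Rightarrow> 'a picture set \<Rightarrow> bool" where
  "buchi_recognizable \<Sigma> L \<longleftrightarrow>
     (\<exists>(A :: ('a, nat) tiling_system) F.
        tiling_system A \<and> ts_alphabet A = \<Sigma> \<and> F \<subseteq> ts_states A \<and> L = ts_buchi_language A F)"


section \<open>Ordinals\<close>

text \<open>An element \<open>\<alpha>\<close> of a countable well-ordered type stands for the countable ordinal that
  is the order type of \<open>{..<\<alpha>}\<close>. Every countable ordinal arises in this way.\<close>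

definition ord_zero :: "'i::wellorder" where
  "ord_zero = (LEAST i. True)"

text \<open>Only meaningful if \<open>i\<close> is not the greatest element of the type.\<close>

definition ord_suc :: "'i::wellorder \<Rightarrow> 'i" where
  "ord_suc i = (LEAST j. i < j)"

definition ord_limit :: "'i::wellorder \<Rightarrow> bool" where
  "ord_limit i \<longleftrightarrow> i \<noteq> ord_zero \<and> \<not> (\<exists>j<i. i = ord_suc j)"

definition ord_words :: "'a set \<Rightarrow> 'i::wellorder \<Rightarrow> ('i \<Rightarrow> 'a) set" where
  "ord_words \<Sigma> \<alpha> = ({..<\<alpha>} \<rightarrow>\<^sub>E \<Sigma>)"


section \<open>Ordinal Buechi automata\<close>

record ('a, 'q) ord_automaton =
  oa_alphabet :: "'a set"
  oa_states :: "'q set"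
  oa_init :: "'q"
  oa_trans :: "('q \<times> 'a \<times> 'q) set"
  oa_limit :: "('q set \<times> 'q) set"
  oa_final :: "'q set"

definition ord_automaton :: "('a, 'q) ord_automaton \<Rightarrow> bool" where
  "ord_automaton B \<longleftrightarrow>
     finite (oa_alphabet B) \<and> finite (oa_states B) \<and> oa_init B \<in> oa_states B \<and>
     oa_trans B \<subseteq> oa_states B \<times> oa_alphabet B \<times> oa_states B \<and>
     oa_limit B \<subseteq> Pow (oa_states B) \<times> oa_states B \<and>
     oa_final B \<subseteq> oa_states B"

definition oa_Inf :: "('a, 'q) ord_automaton \<Rightarrow> ('i::wellorder \<Rightarrow> 'q) \<Rightarrow> 'i \<Rightarrow> 'q set" where
  "oa_Inf B x i = {q \<in> oa_states B. \<forall>\<mu><i. \<exists>\<nu><i. \<mu> < \<nu> \<and> x \<nu> = q}"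

text \<open>The \<open>(\<alpha>+1)\<close>-sequence \<open>x\<close> is indexed by \<open>{..\<alpha>}\<close>.\<close>

definition oa_run ::
  "('a, 'q) ord_automaton \<Rightarrow> 'i::{wellorder,countable} \<Rightarrow> ('i \<Rightarrow> 'a) \<Rightarrow> ('i \<Rightarrow> 'q) \<Rightarrow> bool" where
  "oa_run B \<alpha> \<sigma> x \<longleftrightarrow>
     x \<in> {..\<alpha>} \<rightarrow> oa_states B \<and>
     x ord_zero = oa_init B \<and>
     (\<forall>i<\<alpha>. (x i, \<sigma> i, x (ord_suc i)) \<in> oa_trans B) \<and>
     (\<forall>i\<le>\<alpha>. ord_limit i \<longrightarrow> (oa_Inf B x i, x i) \<in> oa_limit B)"

definition oa_accepts ::
  "('a, 'q) ord_automaton \<Rightarrow> 'i::{wellorder,countable} \<Rightarrow> ('i \<Rightarrow> 'a) \<Rightarrow> bool" where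
  "oa_accepts B \<alpha> \<sigma> \<longleftrightarrow> (\<exists>x. oa_run B \<alpha> \<sigma> x \<and> x \<alpha> \<in> oa_final B)"

definition oa_language ::
  "('a, 'q) ord_automaton \<Rightarrow> 'i::{wellorder,countable} \<Rightarrow> ('i \<Rightarrow> 'a) set" where
  "oa_language B \<alpha> = {\<sigma> \<in> ord_words (oa_alphabet B) \<alpha>. oa_accepts B \<alpha> \<sigma>}"


section \<open>The ordinal \<open>\<omega>\<^sup>2\<close> and row-by-row acceptance\<close>

text \<open>Lexicographically ordered triples \<open>(k, n, m)\<close> are the ordinals
  \<open>\<omega>\<^sup>2 \<cdot> k + \<omega> \<cdot> n + m\<close> below \<open>\<omega>\<^sup>3\<close> in Cantor normal form.\<close>

type_synonym ord3 = "nat \<times> nat \<times> nat"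

definition omega2 :: ord3 where
  "omega2 = (1, 0, 0)"

lemma less_omega2_iff: "(k, n, m) < omega2 \<longleftrightarrow> k = 0"
  by (auto simp: omega2_def)

lemma ord_zero_ord3: "ord_zero = ((0, 0, 0) :: ord3)"
  unfolding ord_zero_def by (rule Least_equality) auto

lemma ord_suc_ord3: "ord_suc ((k, n, m) :: ord3) = (k, n, Suc m)"
  unfolding ord_suc_def by (rule Least_equality) auto

lemma ord_limit_ord3: "ord_limit ((k, n, m) :: ord3) \<longleftrightarrow> m = 0 \<and> (k, n) \<noteq> (0, 0)"
  by (cases m) (auto simp: ord_limit_def ord_zero_ord3 ord_suc_ord3)

definition regular_omega2 :: "'a set \<Rightarrow> (ord3 \<Rightarrow> 'a) set \<Rightarrow> bool" where
  "regular_omega2 \<Sigma> W \<longleftrightarrow>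
     (\<exists>B :: ('a, nat) ord_automaton.
        ord_automaton B \<and> oa_alphabet B = \<Sigma> \<and> W = oa_language B omega2)"

definition row_word :: "'a picture \<Rightarrow> ord3 \<Rightarrow> 'a" where
  "row_word p = restrict (\<lambda>(k, n, m). the (p (m + 1, n + 1))) {..<omega2}"

definition accepted_row_by_row :: "'a set \<Rightarrow> 'a picture set \<Rightarrow> bool" where
  "accepted_row_by_row \<Sigma> L \<longleftrightarrow> regular_omega2 \<Sigma> (row_word ` L)"

end

theory Submission
  imports Defs "HOL-Library.Infinite_Set"
begin

text \<open>(i) A tiling guesses the run of the ordinal automaton row by row, the limit state after
  each row being guessed in column \<open>0\<close>, so that consecutive rows are linked locally. What remains
  is a Muller condition on every row; the limit at \<open>\<omega>\<^sup>2\<close> becomes one as well, on the border row,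
  once the set of states met in each row is transported there along antidiagonals. All these row
  conditions are checked by a single Buechi condition: infinitely many columns are guessed as
  checkpoints, and at the \<open>k\<close>-th checkpoint the first \<open>k\<close> rows must have seen exactly their
  guessed limit sets since the previous one.

  (ii) The pictures all of whose rows are equal are recognized by a tiling system. An ordinal
  automaton remembers only one of finitely many states after the first row, so two accepting runs
  on different pictures can be spliced there.\<close>

section \<open>Values taken infinitely often\<close>

definition inf_vals :: "(nat \<Rightarrow> 'b) \<Rightarrow> 'b set" where
  "inf_vals f = {s. infinite {i. f i = s}}"

lemma inf_vals_subset_range: "inf_vals f \<subseteq> range f"
proof
  fix s assume "s \<in> inf_vals f"
  then have "{i. f i = s} \<noteq> {}"
    unfolding inf_vals_def by (metis finite.emptyI mem_Collect_eq)
  then show "s \<in> range f" by auto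
qed

lemma infinite_nat_Collect_iff: "infinite {i::nat. P i} \<longleftrightarrow> (\<forall>m. \<exists>i>m. P i)"
  by (simp add: infinite_nat_iff_unbounded)

text \<open>Each of the finitely many values outside \<open>inf_vals f\<close> is taken only
  finitely often, so together they occupy finitely many indices.\<close>

lemma eventually_in_inf_vals:
  assumes "finite (range f)"
  shows "eventually (\<lambda>i. f i \<in> inf_vals f) sequentially"
proof -
  have "{i. f i \<notin> inf_vals f} \<subseteq> (\<Union>s \<in> range f - inf_vals f. {i. f i = s})"
    by auto
  moreover have "finite \<dots>"
    using assms by (auto simp: inf_vals_def)
  ultimately have "finite {i. f i \<notin> inf_vals f}"
    by (rule finite_subset)
  then show ?thesis
    by (simp add: eventually_cofinite flip: cofinite_eq_sequentially)
qed

text \<open>From left to right: late indices carry only recurring values of \<open>f\<close>, so a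
  recurring \<open>t\<close> has a recurring preimage under \<open>g\<close>.\<close>

lemma inf_vals_comp:
  assumes "finite (range f)"
  shows "inf_vals (\<lambda>i. g (f i)) = g ` inf_vals f"
proof (intro set_eqI iffI)
  fix t assume "t \<in> inf_vals (\<lambda>i. g (f i))"
  then have *: "infinite {i. g (f i) = t}"
    by (simp add: inf_vals_def)
  obtain m where m: "\<And>i. i \<ge> m \<Longrightarrow> f i \<in> inf_vals f"
    using eventually_in_inf_vals[OF assms] by (auto simp: eventually_sequentially)
  obtain i where "i > m" "g (f i) = t"
    using * unfolding infinite_nat_Collect_iff by blast
  then show "t \<in> g ` inf_vals f" using m[of i] by auto
next
  fix t assume "t \<in> g ` inf_vals f"
  then obtain s where s: "infinite {i. f i = s}" "t = g s"
    by (auto simp: inf_vals_def)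
  have "{i. f i = s} \<subseteq> {i. g (f i) = t}" using s(2) by auto
  then show "t \<in> inf_vals (\<lambda>i. g (f i))"
    using s(1) infinite_super by (auto simp: inf_vals_def)
qed

lemma infinite_Collect_Suc_iff: "infinite {i. P (Suc i)} \<longleftrightarrow> infinite {i. P i}"
  unfolding infinite_nat_Collect_iff
  by (metis Suc_lessE Suc_lessD lessI less_trans_Suc Suc_less_eq)

lemma inf_vals_Suc: "inf_vals (\<lambda>i. f (Suc i)) = inf_vals f"
  unfolding inf_vals_def infinite_Collect_Suc_iff[of "\<lambda>i. f i = _"] ..

text \<open>This is \<open>inf_vals_comp\<close> applied to the truth value of
  \<open>q \<in> f i\<close>.\<close>

lemma Union_inf_vals:
  assumes "finite (range f)"
  shows "\<Union> (inf_vals f) = {q. infinite {i. q \<in> f i}}"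
proof -
  have "inf_vals (\<lambda>i. q \<in> f i) = (\<lambda>A. q \<in> A) ` inf_vals f" for q
    by (rule inf_vals_comp[OF assms])
  then have "True \<in> inf_vals (\<lambda>i. q \<in> f i) \<longleftrightarrow> (\<exists>A \<in> inf_vals f. q \<in> A)" for q
    by auto
  then show ?thesis by (auto simp: inf_vals_def)
qed

section \<open>Tiling systems over arbitrary finite state sets\<close>

text \<open>The local constraint is kept apart from the finite state set, so that states may have
  any convenient type.\<close>

definition tiled ::
  "(('a, 'q) cell \<Rightarrow> ('a, 'q) cell \<Rightarrow> ('a, 'q) cell \<Rightarrow> ('a, 'q) cell \<Rightarrow> bool) \<Rightarrow>
    'a picture \<Rightarrow> (nat \<times> nat \<Rightarrow> 'q) \<Rightarrow> bool" where
  "tiled T p \<rho> \<longleftrightarrow> (\<forall>i j. T (p (i, j), \<rho> (i, j)) (p (Suc i, j), \<rho> (Suc i, j))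
      (p (i, Suc j), \<rho> (i, Suc j)) (p (Suc i, Suc j), \<rho> (Suc i, Suc j)))"

lemma pictures_bordered: "p \<in> pictures \<Sigma> \<Longrightarrow> p v \<in> bordered \<Sigma>"
  by (cases v; cases "fst v = 0 \<or> snd v = 0") (auto simp: pictures_def bordered_def)

lemma pictures_eq_None_iff: "p \<in> pictures \<Sigma> \<Longrightarrow> p (i, j) = None \<longleftrightarrow> i = 0 \<or> j = 0"
proof (cases "i = 0 \<or> j = 0")
  case False
  assume "p \<in> pictures \<Sigma>"
  with False have "p (i, j) \<in> Some ` \<Sigma>" by (simp add: pictures_def)
  with False show ?thesis by auto
qed (auto simp: pictures_def)

text \<open>An injection of \<open>Q\<close> into the numbers renames the states; runs are carried
  over by \<open>f\<close> and back by its inverse on \<open>Q\<close>.\<close>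

lemma buchi_recognizable_tiled:
  fixes Q :: "'q set" and \<Sigma> :: "'a set"
  assumes "finite \<Sigma>" "finite Q"
  shows "buchi_recognizable \<Sigma>
    {p \<in> pictures \<Sigma>. \<exists>\<rho>. range \<rho> \<subseteq> Q \<and> tiled T p \<rho> \<and> infinite {v. \<rho> v \<in> F}}"
    (is "buchi_recognizable \<Sigma> ?L")
proof -
  obtain f :: "'q \<Rightarrow> nat" where f: "inj_on f Q"
    using finite_imp_inj_to_nat_seg[OF assms(2)] by blast
  define g where "g = inv_into Q f"
  define C where "C = bordered \<Sigma> \<times> f ` Q"
  define A :: "('a, nat) tiling_system" where
    "A = \<lparr>ts_states = f ` Q, ts_alphabet = \<Sigma>, ts_tiles = {(c1, c2, c3, c4).
       c1 \<in> C \<and> c2 \<in> C \<and> c3 \<in> C \<and> c4 \<in> C \<and>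
       T (map_prod id g c1) (map_prod id g c2) (map_prod id g c3) (map_prod id g c4)}\<rparr>"
  have gf: "g (f q) = q" if "q \<in> Q" for q
    using f that by (simp add: g_def)
  have run: "ts_run A p \<rho> \<longleftrightarrow> range \<rho> \<subseteq> f ` Q \<and> tiled T p (g \<circ> \<rho>)" if "p \<in> pictures \<Sigma>" for p \<rho>
  proof -
    have "(p v, \<rho> v) \<in> C" if "range \<rho> \<subseteq> f ` Q" for v
      using that pictures_bordered[OF \<open>p \<in> pictures \<Sigma>\<close>] by (auto simp: C_def)
    then show ?thesis
      by (auto simp: ts_run_def tiled_def A_def)
  qed
  have "tiling_system A"
    unfolding tiling_system_def Let_def using assms by (auto simp: A_def C_def)
  moreover have "ts_alphabet A = \<Sigma>" by (simp add: A_def)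
  moreover have "f ` (F \<inter> Q) \<subseteq> ts_states A" by (auto simp: A_def)
  moreover have "?L = ts_buchi_language A (f ` (F \<inter> Q))"
  proof (intro set_eqI iffI)
    fix p assume "p \<in> ?L"
    then obtain \<rho> where p: "p \<in> pictures \<Sigma>" and \<rho>: "range \<rho> \<subseteq> Q" "tiled T p \<rho>"
      "infinite {v. \<rho> v \<in> F}" by auto
    have "g \<circ> (f \<circ> \<rho>) = \<rho>" using \<rho>(1) gf by (auto simp: fun_eq_iff)
    then have "ts_run A p (f \<circ> \<rho>)" using \<rho> by (subst run[OF p]) auto
    moreover have "{v. \<rho> v \<in> F} \<subseteq> {v. (f \<circ> \<rho>) v \<in> f ` (F \<inter> Q)}" using \<rho>(1) by auto
    then have "infinite {v. (f \<circ> \<rho>) v \<in> f ` (F \<inter> Q)}" using \<rho>(3) infinite_super by blast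
    ultimately show "p \<in> ts_buchi_language A (f ` (F \<inter> Q))"
      using p by (auto simp: ts_buchi_language_def A_def)
  next
    fix p assume "p \<in> ts_buchi_language A (f ` (F \<inter> Q))"
    then obtain \<rho> where p: "p \<in> pictures \<Sigma>" and \<rho>: "ts_run A p \<rho>"
      "infinite {v. \<rho> v \<in> f ` (F \<inter> Q)}" by (auto simp: ts_buchi_language_def A_def)
    have r: "range \<rho> \<subseteq> f ` Q" "tiled T p (g \<circ> \<rho>)" using \<rho>(1) run[OF p] by auto
    have "range (g \<circ> \<rho>) \<subseteq> Q" using r(1) gf by fastforce
    moreover have "{v. \<rho> v \<in> f ` (F \<inter> Q)} \<subseteq> {v. (g \<circ> \<rho>) v \<in> F}" using gf by auto
    then have "infinite {v. (g \<circ> \<rho>) v \<in> F}" using \<rho>(2) infinite_super by blast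
    ultimately show "p \<in> ?L" using p r(2) by blast
  qed
  ultimately show ?thesis unfolding buchi_recognizable_def by blast
qed

section \<open>Muller conditions on all rows\<close>

text \<open>A cell \<open>(q, S, c, l, d, z)\<close> consists of the original state \<open>q\<close>, the guess \<open>S\<close> of the states
  occurring infinitely often in the row, a bit \<open>c\<close> marking the checkpoint columns, a bit \<open>l\<close>
  marking the active part of the column, the set \<open>d\<close> of states seen in the row since the last
  checkpoint, and a bit \<open>z\<close> marking row \<open>0\<close>. Every checkpoint activates one more row, so that
  every row is eventually active as soon as there are infinitely many checkpoints.\<close>

type_synonym 'q row_cell = "'q \<times> 'q set \<times> bool \<times> bool \<times> 'q set \<times> bool"

text \<open>The border locates a tile: \<open>a2 = None\<close> puts its lower side in row 0,
  \<open>a3 = None\<close> its left side in column 0. At a checkpoint the bit \<open>l\<close> moves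
  up one row, \<open>d\<close> restarts, and active rows must have confirmed their guess
  \<open>S\<close>.\<close>

fun row_tile ::
  "(('a, 'q) cell \<Rightarrow> ('a, 'q) cell \<Rightarrow> ('a, 'q) cell \<Rightarrow> ('a, 'q) cell \<Rightarrow> bool) \<Rightarrow>
   ('q \<Rightarrow> 'q set \<Rightarrow> bool) \<Rightarrow> ('a, 'q row_cell) cell \<Rightarrow> ('a, 'q row_cell) cell \<Rightarrow>
   ('a, 'q row_cell) cell \<Rightarrow> ('a, 'q row_cell) cell \<Rightarrow> bool" where
  "row_tile T W (a1, q1, S1, c1, l1, d1, z1) (a2, q2, S2, c2, l2, d2, z2)
     (a3, q3, S3, c3, l3, d3, z3) (a4, q4, S4, c4, l4, d4, z4) \<longleftrightarrow>
     T (a1, q1) (a2, q2) (a3, q3) (a4, q4) \<and>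
     z1 = (a2 = None) \<and> (a3 = None \<longrightarrow> W q1 S1 \<and> \<not> l1) \<and> S2 = S1 \<and> c3 = c1 \<and>
     (a2 = None \<longrightarrow> l2 = (l1 \<or> c1)) \<and> l4 = (if c1 then l1 else l3) \<and>
     d2 = (if c1 then {q2} else insert q2 d1) \<and> (c1 \<longrightarrow> l1 \<longrightarrow> d1 = S1)"

text \<open>If every late gap between checkpoints collects exactly \<open>S\<close>, then each
  element of \<open>S\<close> recurs gap after gap, and any value taken late is collected by the end
  of its gap.\<close>

lemma inf_vals_eq_checkpoint_set:
  fixes f :: "nat \<Rightarrow> 'q"
  assumes c: "\<forall>m. \<exists>i>m. c i"
    and d: "\<And>i. d (Suc i) = (if c i then {f (Suc i)} else insert (f (Suc i)) (d i))"
    and S: "\<And>i. i \<ge> i0 \<Longrightarrow> c i \<Longrightarrow> d i = S"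
  shows "inf_vals f = S"
proof (intro set_eqI iffI)
  fix s assume "s \<in> S"
  have "\<exists>i>m. f i = s" for m
  proof -
    obtain a where a: "a > max m i0" "c a" using c by blast
    obtain b where b: "b > a" "c b" using c by blast
    \<comment> \<open>Further checkpoints between \<open>a\<close> and \<open>b\<close> only discard
      values, so the inclusion holds although \<open>b\<close> need not be the next one.\<close>
    have "d b \<subseteq> f ` {a<..b}" using b(1)
    proof (induction b)
      case (Suc b)
      then show ?case
        using a(2) d[of b] by (cases "b = a") (auto split: if_splits)
    qed simp
    moreover have "d b = S" using S[of b] a b by auto
    ultimately obtain i where "i \<in> {a<..b}" "s = f i" using \<open>s \<in> S\<close> by auto
    then show ?thesis using a by (intro exI[of _ i]) auto
  qed
  then show "s \<in> inf_vals f" by (simp add: inf_vals_def infinite_nat_Collect_iff)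
next
  fix s assume "s \<in> inf_vals f"
  then have inf: "\<forall>m. \<exists>i>m. f i = s" by (simp add: inf_vals_def infinite_nat_Collect_iff)
  obtain i where i: "i > i0" "f i = s" using inf by blast
  have ex: "\<exists>b. b \<ge> i \<and> c b" using c less_imp_le by blast
  \<comment> \<open>At the first checkpoint from \<open>i\<close> on, \<open>f i\<close> is still in
    \<open>d\<close>, as no restart has happened since it was inserted.\<close>
  define b where "b = (LEAST b. b \<ge> i \<and> c b)"
  have b: "b \<ge> i" "c b" using LeastI_ex[OF ex] by (auto simp: b_def)
  have least: "\<not> c l" if "i \<le> l" "l < b" for l
    using that not_less_Least[of l "\<lambda>b. b \<ge> i \<and> c b"] by (auto simp: b_def)
  have "k \<le> b \<Longrightarrow> f i \<in> d k" if "i \<le> k" for k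
    using that
  proof (induction k rule: dec_induct)
    case base
    then show ?case using i(1) d[of "i - 1"] by (cases i) auto
  next
    case (step k)
    then show ?case using least[of k] d[of k] by auto
  qed
  then have "f i \<in> d b" using b by auto
  then show "s \<in> S" using S[of b] b i by auto
qed

text \<open>Stage \<open>k\<close> concerns only the rows up to \<open>k\<close>: \<open>n k\<close>
  is so late that they take only recurring values afterwards (\<open>?P\<close>), and
  \<open>n (Suc k)\<close> so far beyond that all of these have been taken
  (\<open>?R\<close>).\<close>

lemma exists_checkpoints:
  fixes f :: "nat \<Rightarrow> nat \<Rightarrow> 'q"
  assumes fin: "\<And>j. finite (range (f j))"
  shows "\<exists>n :: nat \<Rightarrow> nat. strict_mono n \<and> (\<forall>k. \<forall>j\<le>k. f j ` {n k<..n (Suc k)} = inf_vals (f j))"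
proof -
  let ?P = "\<lambda>k m. \<forall>j\<in>{..k}. \<forall>i>m. f j i \<in> inf_vals (f j)"
  let ?R = "\<lambda>k m m'. m < m' \<and> (\<forall>j\<in>{..k}. inf_vals (f j) \<subseteq> f j ` {m<..m'})"
  have settled: "eventually (?P k) sequentially" for k
  proof (intro eventually_ball_finite ballI)
    fix j
    obtain N where N: "\<And>i. i \<ge> N \<Longrightarrow> f j i \<in> inf_vals (f j)"
      using eventually_in_inf_vals[OF fin[of j]] by (auto simp: eventually_sequentially)
    then show "eventually (\<lambda>m. \<forall>i>m. f j i \<in> inf_vals (f j)) sequentially"
      unfolding eventually_sequentially by (intro exI[of _ N]) auto
  qed simp
  have covered: "eventually (?R k m) sequentially" for k m
  proof (intro eventually_conj eventually_ball_finite ballI)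
    fix j
    have "finite (inf_vals (f j))"
      using fin[of j] inf_vals_subset_range finite_subset by metis
    moreover have "eventually (\<lambda>m'. s \<in> f j ` {m<..m'}) sequentially" if "s \<in> inf_vals (f j)" for s
    proof -
      have "\<exists>i>m. f j i = s"
        using that by (simp add: inf_vals_def infinite_nat_Collect_iff)
      then obtain i where "i > m" "s = f j i" by blast
      then show ?thesis
        unfolding eventually_sequentially by (intro exI[of _ i]) auto
    qed
    ultimately have "eventually (\<lambda>m'. \<forall>s\<in>inf_vals (f j). s \<in> f j ` {m<..m'}) sequentially"
      by (intro eventually_ball_finite) auto
    then show "eventually (\<lambda>m'. inf_vals (f j) \<subseteq> f j ` {m<..m'}) sequentially"
      by (simp add: subset_eq)
  qed (auto simp: eventually_gt_at_top)
  have start: "\<exists>m. ?P 0 m"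
    using eventually_happens[OF settled[of 0]] by auto
  have step: "\<exists>m'. ?P (Suc k) m' \<and> ?R k m m'" for k m
    using eventually_happens[OF eventually_conj[OF settled[of "Suc k"] covered[of m k]]] by auto
  have "\<exists>n. \<forall>k. ?P k (n k) \<and> ?R k (n k) (n (Suc k))"
    by (rule dependent_nat_choice[OF start step])
  then obtain n where n: "\<And>k. ?P k (n k)" "\<And>k. ?R k (n k) (n (Suc k))" by metis
  have "strict_mono n" using n(2) by (auto simp: strict_mono_Suc_iff)
  moreover have "f j ` {n k<..n (Suc k)} = inf_vals (f j)" if "j \<le> k" for j k
    using n(1)[of k] n(2)[of k] that by (intro equalityI) auto
  ultimately show ?thesis by blast
qed

text \<open>Given a run, \<open>exists_checkpoints\<close> supplies checkpoints at which the true
  limit sets pass the test; conversely \<open>inf_vals_eq_checkpoint_set\<close> shows that guesses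
  passing it are true.\<close>

lemma buchi_recognizable_row_inf:
  fixes Q :: "'q set" and \<Sigma> :: "'a set"
  assumes "finite \<Sigma>" "finite Q"
  shows "buchi_recognizable \<Sigma>
    {p \<in> pictures \<Sigma>. \<exists>\<rho>. range \<rho> \<subseteq> Q \<and> tiled T p \<rho> \<and>
       (\<forall>j. W (\<rho> (0, j)) (inf_vals (\<lambda>i. \<rho> (i, j))))}"
    (is "buchi_recognizable \<Sigma> ?L")
proof -
  define Q' where "Q' = Q \<times> Pow Q \<times> (UNIV :: bool set) \<times> (UNIV :: bool set) \<times> Pow Q \<times> (UNIV :: bool set)"
  \<comment> \<open>Restricting to row 0 matters: a single checkpoint column already has infinitely
    many cells.\<close>
  define F :: "'q row_cell set" where "F = {(q, S, c, l, d, z). c \<and> z}"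
  have "finite Q'" using assms(2) by (auto simp: Q'_def)
  have "?L = {p \<in> pictures \<Sigma>. \<exists>\<rho>. range \<rho> \<subseteq> Q' \<and> tiled (row_tile T W) p \<rho> \<and> infinite {v. \<rho> v \<in> F}}"
    (is "_ = ?R")
  proof (intro set_eqI iffI)
    fix p assume "p \<in> ?L"
    then obtain \<rho> where p: "p \<in> pictures \<Sigma>" and \<rho>: "range \<rho> \<subseteq> Q" "tiled T p \<rho>"
      "\<And>j. W (\<rho> (0, j)) (inf_vals (\<lambda>i. \<rho> (i, j)))" by auto
    define S where "S j = inf_vals (\<lambda>i. \<rho> (i, j))" for j
    have "finite (range (\<lambda>i. \<rho> (i, j)))" for j
      by (rule finite_subset[OF _ assms(2)]) (use \<rho>(1) in auto)
    from exists_checkpoints[of "\<lambda>j i. \<rho> (i, j)", OF this]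
    obtain n :: "nat \<Rightarrow> nat" where n: "strict_mono n"
      and nS: "\<And>j k. j \<le> k \<Longrightarrow> (\<lambda>i. \<rho> (i, j)) ` {n k<..n (Suc k)} = S j"
      by (auto simp: S_def)
    have n_less: "n a < n b \<longleftrightarrow> a < b" and n_le: "n a \<le> n b \<longleftrightarrow> a \<le> b" for a b
      using n by (simp_all add: strict_mono_less strict_mono_less_eq)
    define c where "c i \<longleftrightarrow> i \<in> range n" for i
    define d where "d i j = {\<rho> (l, j) | l. l \<le> i \<and> (\<forall>k. l \<le> k \<longrightarrow> k < i \<longrightarrow> \<not> c k)}" for i j
    \<comment> \<open>Row \<open>j\<close> is active strictly after \<open>n j\<close>, so the test
      at \<open>n k\<close> concerns the rows \<open>j < k\<close>, for which the gap ending there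
      is exact.\<close>
    define \<rho>' where "\<rho>' = (\<lambda>(i, j). (\<rho> (i, j), S j, c i, n j < i, d i j, j = 0))"
    have d_Suc: "d (Suc i) j =
        (if c i then {\<rho> (Suc i, j)} else insert (\<rho> (Suc i, j)) (d i j))" for i j
      by (auto simp: d_def le_Suc_eq less_Suc_eq)
    have dS: "d i j = S j" if "c i" "n j < i" for i j
    proof -
      obtain k where k: "i = n k" using \<open>c i\<close> by (auto simp: c_def)
      with that obtain k' where k': "k = Suc k'" "j \<le> k'"
        using n_less by (cases k) auto
      have "(\<forall>k. l \<le> k \<longrightarrow> k < n (Suc k') \<longrightarrow> \<not> c k) \<longleftrightarrow> n k' < l" for l
      proof
        assume "\<forall>k. l \<le> k \<longrightarrow> k < n (Suc k') \<longrightarrow> \<not> c k"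
        then show "n k' < l" using n_less[of k' "Suc k'"] by (auto simp: c_def not_le)
      next
        assume "n k' < l"
        have "\<not> c m" if "l \<le> m" "m < n (Suc k')" for m
        proof
          assume "c m"
          then obtain b where "m = n b" by (auto simp: c_def)
          then have "n k' < n b" "n b < n (Suc k')" using that \<open>n k' < l\<close> by auto
          then show False by (auto simp: n_less)
        qed
        then show "\<forall>k. l \<le> k \<longrightarrow> k < n (Suc k') \<longrightarrow> \<not> c k" by blast
      qed
      then have "d i j = (\<lambda>i. \<rho> (i, j)) ` {n k'<..n (Suc k')}"
        by (auto simp: d_def k k')
      then show ?thesis using nS[OF k'(2)] by simp
    qed
    have S_sub: "S j \<subseteq> Q" for j
      using inf_vals_subset_range[of "\<lambda>i. \<rho> (i, j)"] \<rho>(1) by (auto simp: S_def)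
    have "d i j \<subseteq> Q" for i j using \<rho>(1) by (auto simp: d_def)
    then have "range \<rho>' \<subseteq> Q'" using \<rho>(1) by (auto simp: \<rho>'_def Q'_def dest: subsetD[OF S_sub] subsetD)
    moreover have "tiled (row_tile T W) p \<rho>'"
    proof -
      have "l2 = (l1 \<or> c i)" if "l2 = (n 0 < Suc i)" "l1 = (n 0 < i)" for l1 l2 i
      proof -
        have "c i \<Longrightarrow> n 0 \<le> i" "\<not> c i \<Longrightarrow> n 0 \<noteq> i" using n_le[of 0] by (auto simp: c_def)
        then show ?thesis using that by auto
      qed
      \<comment> \<open>At a checkpoint \<open>i = n k\<close> both sides say
        \<open>j < k\<close>.\<close>
      moreover have "(n (Suc j) < Suc i) = (if c i then n j < i else n (Suc j) < i)" for i j
      proof (cases "c i")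
        case True
        then obtain k where "i = n k" by (auto simp: c_def)
        with True show ?thesis by (simp add: n_le n_less less_Suc_eq_le Suc_le_eq)
      next
        case False
        then have "n (Suc j) \<noteq> i" by (auto simp: c_def)
        with False show ?thesis by (simp add: less_Suc_eq)
      qed
      ultimately show ?thesis
        using \<rho>(2) \<rho>(3) dS d_Suc unfolding tiled_def \<rho>'_def
        by (simp add: pictures_eq_None_iff[OF p] S_def)
    qed
    moreover have "infinite {v. \<rho>' v \<in> F}"
    proof -
      have "inj (\<lambda>k. (n k, 0 :: nat))"
        using strict_mono_imp_inj_on[OF n] by (auto simp: inj_on_def)
      then have "infinite (range (\<lambda>k. (n k, 0 :: nat)))"
        by (simp add: finite_image_iff)
      moreover have "range (\<lambda>k. (n k, 0)) \<subseteq> {v. \<rho>' v \<in> F}"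
        by (auto simp: \<rho>'_def F_def c_def)
      ultimately show ?thesis using infinite_super by blast
    qed
    ultimately show "p \<in> ?R" using p by blast
  next
    fix p assume "p \<in> ?R"
    then obtain \<rho>' where p: "p \<in> pictures \<Sigma>" and \<rho>': "range \<rho>' \<subseteq> Q'"
      "tiled (row_tile T W) p \<rho>'" "infinite {v. \<rho>' v \<in> F}" by auto
    define \<rho> where "\<rho> v = fst (\<rho>' v)" for v
    define S where "S v = fst (snd (\<rho>' v))" for v
    define c where "c v = fst (snd (snd (\<rho>' v)))" for v
    define l where "l v = fst (snd (snd (snd (\<rho>' v))))" for v
    define d where "d v = fst (snd (snd (snd (snd (\<rho>' v)))))" for v
    define z where "z v = snd (snd (snd (snd (snd (\<rho>' v)))))" for v
    have \<rho>'_eq: "\<rho>' v = (\<rho> v, S v, c v, l v, d v, z v)" for v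
      by (simp add: \<rho>_def S_def c_def l_def d_def z_def)
    note tile = \<rho>'(2)[unfolded tiled_def \<rho>'_eq, simplified pictures_eq_None_iff[OF p] row_tile.simps]
    have z: "z (i, j) \<longleftrightarrow> j = 0" for i j using tile by auto
    have W: "W (\<rho> (0, j)) (S (0, j))" for j using tile by auto
    have S: "S (i, j) = S (0, j)" for i j using tile by (induction i) auto
    have c: "c (i, j) = c (i, 0)" for i j using tile by (induction j) auto
    have d: "d (Suc i, j) = (if c (i, 0) then {\<rho> (Suc i, j)} else insert (\<rho> (Suc i, j)) (d (i, j)))"
      for i j using tile c by metis
    have dS: "d (i, j) = S (0, j)" if "c (i, 0)" "l (i, j)" for i j
      using tile that c S by metis
    have l0: "l (Suc i, 0) \<longleftrightarrow> l (i, 0) \<or> c (i, 0)" for i using tile by auto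
    have lS: "l (Suc i, Suc j) \<longleftrightarrow> (if c (i, 0) then l (i, j) else l (i, Suc j))" for i j
      using tile c by metis
    have inf: "\<forall>m. \<exists>i>m. c (i, 0)"
    proof -
      have "{v. \<rho>' v \<in> F} \<subseteq> (\<lambda>i. (i, 0)) ` {i. c (i, 0)}"
        using z by (auto simp: F_def \<rho>'_eq)
      then have "infinite {i. c (i, 0)}"
        using \<rho>'(3) by (meson finite_imageI finite_subset)
      then show ?thesis by (simp add: infinite_nat_Collect_iff)
    qed
    \<comment> \<open>A checkpoint met once row \<open>j\<close> is permanently active activates row
      \<open>Suc j\<close>; later checkpoints copy an active bit again, so it stays active.\<close>
    have low: "\<exists>i0. \<forall>i\<ge>i0. l (i, j)" for j
    proof (induction j)
      case 0
      obtain a where "c (a, 0)" using inf by blast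
      have "l (i, 0)" if "i \<ge> Suc a" for i
        using that by (induction i rule: dec_induct) (auto simp: l0 \<open>c (a, 0)\<close>)
      then show ?case by blast
    next
      case (Suc j)
      then obtain i0 where i0: "\<And>i. i \<ge> i0 \<Longrightarrow> l (i, j)" by blast
      obtain a where a: "a > i0" "c (a, 0)" using inf by blast
      have "l (i, Suc j)" if "i \<ge> Suc a" for i
        using that a i0 by (induction i rule: dec_induct) (auto simp: lS)
      then show ?case by blast
    qed
    have "inf_vals (\<lambda>i. \<rho> (i, j)) = S (0, j)" for j
    proof -
      obtain i0 where "\<And>i. i \<ge> i0 \<Longrightarrow> l (i, j)" using low by blast
      then show ?thesis
        using inf_vals_eq_checkpoint_set[OF inf, of "\<lambda>i. d (i, j)" "\<lambda>i. \<rho> (i, j)" i0 "S (0, j)"]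
          d dS by blast
    qed
    moreover have "range \<rho> \<subseteq> Q" using \<rho>'(1) by (force simp: Q'_def \<rho>'_eq)
    moreover have "tiled T p \<rho>" using tile by (auto simp: tiled_def)
    ultimately show "p \<in> ?L" using p W by (auto intro!: exI[of _ \<rho>])
  qed
  then show ?thesis
    using buchi_recognizable_tiled[OF assms(1) \<open>finite Q'\<close>] by simp
qed

section \<open>Acceptance of words of length \<open>\<omega>\<^sup>2\<close>\<close>

lemma between_in_row_iff:
  "(0, n, m) < (\<nu> :: ord3) \<and> \<nu> < (0, Suc n, 0) \<longleftrightarrow> (\<exists>i>m. \<nu> = (0, n, i))"
  by (cases \<nu>) auto

lemma less_in_row: "(\<mu> :: ord3) < (0, Suc n, 0) \<Longrightarrow> snd (snd \<mu>) < i \<Longrightarrow> \<mu> < (0, n, i)"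
  by (cases \<mu>) auto

text \<open>The positions of row \<open>n\<close> are cofinal below the limit, and beyond any of
  them only row \<open>n\<close> remains.\<close>

lemma oa_Inf_row:
  fixes x :: "ord3 \<Rightarrow> 'q"
  shows "oa_Inf B x (0, Suc n, 0) = oa_states B \<inter> inf_vals (\<lambda>m. x (0, n, m))"
proof -
  let ?t = "(0, Suc n, 0) :: ord3"
  have less_t: "(0, n, i) < ?t" for i by simp
  have eq: "(\<forall>\<mu><?t. \<exists>\<nu><?t. \<mu> < \<nu> \<and> x \<nu> = q) \<longleftrightarrow> (\<forall>m. \<exists>i>m. x (0, n, i) = q)"
    (is "?A \<longleftrightarrow> ?B") for q
  proof
    assume A: ?A
    show ?B
    proof
      fix m
      obtain \<nu> where \<nu>: "(0, n, m) < \<nu> \<and> \<nu> < ?t" and q: "x \<nu> = q"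
        using A[THEN spec, THEN mp, OF less_t[of m]] by metis
      show "\<exists>i>m. x (0, n, i) = q"
        using q iffD1[OF between_in_row_iff \<nu>] by metis
    qed
  next
    assume B: ?B
    show ?A
    proof (intro allI impI)
      fix \<mu> :: ord3 assume \<mu>: "\<mu> < ?t"
      obtain i where i: "i > snd (snd \<mu>)" "x (0, n, i) = q" using B by metis
      show "\<exists>\<nu><?t. \<mu> < \<nu> \<and> x \<nu> = q"
        using less_t[of i] less_in_row[OF \<mu> i(1)] i(2) by metis
    qed
  qed
  show ?thesis
    unfolding oa_Inf_def inf_vals_def infinite_nat_Collect_iff eq by blast
qed

text \<open>Here whole rows are cofinal, so what counts is the number of rows containing
  \<open>q\<close>, not how often each does.\<close>

lemma oa_Inf_omega2:
  "oa_Inf B x omega2 = oa_states B \<inter> {q. infinite {n. \<exists>m. x (0, n, m) = q}}"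
proof -
  have eq: "(\<forall>\<mu><omega2. \<exists>\<nu><omega2. \<mu> < \<nu> \<and> x \<nu> = q) \<longleftrightarrow> (\<forall>n. \<exists>i>n. \<exists>m. x (0, i, m) = q)"
    (is "?A \<longleftrightarrow> ?B") for q
  proof
    assume A: ?A
    show ?B
    proof
      fix n
      have "(0, Suc n, 0) < omega2" by (simp add: less_omega2_iff)
      from A[rule_format, OF this]
      obtain \<nu> where "\<nu> < omega2" "(0, Suc n, 0) < \<nu>" "x \<nu> = q" by blast
      moreover obtain i m where "\<nu> = (0, i, m)"
        using \<open>\<nu> < omega2\<close> by (cases \<nu>) (auto simp: less_omega2_iff)
      ultimately have "n < i \<and> x (0, i, m) = q" by auto
      then show "\<exists>i>n. \<exists>m. x (0, i, m) = q" by blast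
    qed
  next
    assume B: ?B
    show ?A
    proof (intro allI impI)
      fix \<mu> :: ord3 assume "\<mu> < omega2"
      moreover obtain i m where "i > fst (snd \<mu>)" "x (0, i, m) = q" using B by blast
      ultimately show "\<exists>\<nu><omega2. \<mu> < \<nu> \<and> x \<nu> = q"
        by (intro exI[of _ "(0, i, m)"]) (cases \<mu>, auto simp: less_omega2_iff)
    qed
  qed
  show ?thesis
    unfolding oa_Inf_def infinite_nat_Collect_iff eq by blast
qed

text \<open>A successful run cut into rows: \<open>y n m\<close> is the state at \<omega> n + m, and
  the state at \<omega> squared survives only as the witness \<open>f\<close>.\<close>

definition omega2_run :: "('a, 'q) ord_automaton \<Rightarrow> (nat \<Rightarrow> nat \<Rightarrow> 'a) \<Rightarrow> (nat \<Rightarrow> nat \<Rightarrow> 'q) \<Rightarrow> bool" where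
  "omega2_run B w y \<longleftrightarrow>
     (\<forall>n m. y n m \<in> oa_states B) \<and> y 0 0 = oa_init B \<and>
     (\<forall>n m. (y n m, w n m, y n (Suc m)) \<in> oa_trans B) \<and>
     (\<forall>n. (inf_vals (y n), y (Suc n) 0) \<in> oa_limit B) \<and>
     (\<exists>f \<in> oa_final B. ({q. infinite {n. q \<in> range (y n)}}, f) \<in> oa_limit B)"

lemma oa_accepts_omega2_iff:
  assumes "ord_automaton B"
  shows "oa_accepts B omega2 \<sigma> \<longleftrightarrow> (\<exists>y. omega2_run B (\<lambda>n m. \<sigma> (0, n, m)) y)"
proof
  assume "oa_accepts B omega2 \<sigma>"
  then obtain x where x: "oa_run B omega2 \<sigma> x" "x omega2 \<in> oa_final B"
    by (auto simp: oa_accepts_def)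
  define y where "y n m = x (0, n, m)" for n m
  have st: "y n m \<in> oa_states B" for n m
    using x(1) unfolding oa_run_def y_def
    by (meson Pi_mem atMost_iff less_imp_le less_omega2_iff)
  have lim: "(oa_Inf B x i, x i) \<in> oa_limit B" if "i \<le> omega2" "ord_limit i" for i
    using x(1) that unfolding oa_run_def by blast
  have row: "oa_states B \<inter> inf_vals (\<lambda>m. x (0, n, m)) = inf_vals (y n)" for n
    using inf_vals_subset_range[of "y n"] st by (auto simp: y_def[abs_def])
  have row_lim: "(inf_vals (y n), y (Suc n) 0) \<in> oa_limit B" for n
  proof -
    have "(0, Suc n, 0) \<le> omega2" by (rule less_imp_le) (simp add: less_omega2_iff)
    then show ?thesis using lim[of "(0, Suc n, 0)"] by (simp add: oa_Inf_row row y_def ord_limit_ord3)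
  qed
  have "oa_states B \<inter> {q. infinite {n. \<exists>m. x (0, n, m) = q}} = {q. infinite {n. q \<in> range (y n)}}"
  proof -
    have "q \<in> oa_states B" if "infinite {n. q \<in> range (y n)}" for q
      using not_finite_existsD[OF that] st by auto
    moreover have "q \<in> range (y n) \<longleftrightarrow> (\<exists>m. x (0, n, m) = q)" for q n
      by (auto simp: y_def)
    ultimately show ?thesis by auto
  qed
  moreover have "ord_limit omega2" by (simp add: omega2_def ord_limit_ord3)
  ultimately have "({q. infinite {n. q \<in> range (y n)}}, x omega2) \<in> oa_limit B"
    using lim[of omega2] by (simp add: oa_Inf_omega2)
  moreover have "(y n m, \<sigma> (0, n, m), y n (Suc m)) \<in> oa_trans B" for n m
    using x(1) by (auto simp: oa_run_def y_def less_omega2_iff ord_suc_ord3)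
  moreover have "y 0 0 = oa_init B"
    using x(1) by (auto simp: oa_run_def y_def ord_zero_ord3)
  ultimately have "omega2_run B (\<lambda>n m. \<sigma> (0, n, m)) y"
    using st x(2) row_lim by (auto simp: omega2_run_def)
  then show "\<exists>y. omega2_run B (\<lambda>n m. \<sigma> (0, n, m)) y" by blast
next
  assume "\<exists>y. omega2_run B (\<lambda>n m. \<sigma> (0, n, m)) y"
  then obtain y f where st: "\<And>n m. y n m \<in> oa_states B" and init: "y 0 0 = oa_init B"
    and tr: "\<And>n m. (y n m, \<sigma> (0, n, m), y n (Suc m)) \<in> oa_trans B"
    and li: "\<And>n. (inf_vals (y n), y (Suc n) 0) \<in> oa_limit B"
    and f: "f \<in> oa_final B" "({q. infinite {n. q \<in> range (y n)}}, f) \<in> oa_limit B"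
    by (auto simp: omega2_run_def)
  \<comment> \<open>The state at \<open>omega2\<close> is \<open>f\<close>; the same value is the
    default beyond it.\<close>
  define x :: "ord3 \<Rightarrow> _" where "x = (\<lambda>(k, n, m). if k = 0 then y n m else f)"
  have x0: "x (0, n, m) = y n m" for n m by (simp add: x_def)
  have xo: "x omega2 = f" by (simp add: x_def omega2_def)
  have f_st: "f \<in> oa_states B" using f(1) assms by (auto simp: ord_automaton_def)
  have "(oa_Inf B x i, x i) \<in> oa_limit B" if "i \<le> omega2" "ord_limit i" for i
  proof (cases "i = omega2")
    case True
    have "oa_states B \<inter> {q. infinite {n. \<exists>m. y n m = q}} = {q. infinite {n. q \<in> range (y n)}}"
    proof -
      have "q \<in> oa_states B" if "infinite {n. q \<in> range (y n)}" for q
        using not_finite_existsD[OF that] st by auto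
      moreover have "q \<in> range (y n) \<longleftrightarrow> (\<exists>m. y n m = q)" for q n by auto
      ultimately show ?thesis by auto
    qed
    then show ?thesis using f(2) by (simp add: True oa_Inf_omega2 xo x0)
  next
    case False
    then have "i < omega2" using that by simp
    moreover obtain k n' m where knm: "i = (k, n', m)" by (cases i)
    ultimately obtain n where i: "i = (0, Suc n, 0)"
      using \<open>ord_limit i\<close> by (cases n') (auto simp: less_omega2_iff ord_limit_ord3)
    have "oa_states B \<inter> inf_vals (y n) = inf_vals (y n)"
      using inf_vals_subset_range[of "y n"] st by auto
    then show ?thesis using li[of n] by (simp add: i oa_Inf_row x0)
  qed
  then have "oa_run B omega2 \<sigma> x"
    using st init tr f_st
    by (auto simp: oa_run_def x0 less_omega2_iff ord_zero_ord3 ord_suc_ord3 x_def)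
  then show "oa_accepts B omega2 \<sigma>" using f(1) xo by (auto simp: oa_accepts_def)
qed

section \<open>Pictures and their row words\<close>

lemma row_word_apply: "row_word p (0, n, m) = the (p (Suc m, Suc n))"
  by (simp add: row_word_def less_omega2_iff)

lemma row_word_in_ord_words:
  assumes "p \<in> pictures \<Sigma>"
  shows "row_word p \<in> ord_words \<Sigma> omega2"
proof -
  have "the (p (Suc m, Suc n)) \<in> \<Sigma>" for m n
  proof -
    have "p (Suc m, Suc n) \<in> Some ` \<Sigma>" using assms by (simp add: pictures_def)
    then show ?thesis by auto
  qed
  then show ?thesis
    unfolding ord_words_def row_word_def restrict_PiE_iff by (auto simp: less_omega2_iff)
qed

text \<open>The word omits only the border, which all pictures share.\<close>

lemma inj_on_row_word: "inj_on row_word (pictures \<Sigma>)"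
proof (rule inj_onI, rule ext)
  fix p p' :: "'a picture" and v :: "nat \<times> nat"
  assume p: "p \<in> pictures \<Sigma>" and p': "p' \<in> pictures \<Sigma>" and eq: "row_word p = row_word p'"
  obtain i j where v: "v = (i, j)" by (cases v)
  show "p v = p' v"
  proof (cases "i = 0 \<or> j = 0")
    case True
    then show ?thesis using pictures_eq_None_iff[OF p] pictures_eq_None_iff[OF p'] v by metis
  next
    case False
    then obtain m n where mn: "i = Suc m" "j = Suc n" by (metis not0_implies_Suc)
    have "the (p v) = the (p' v)"
      using row_word_apply[of p n m] row_word_apply[of p' n m] eq by (simp add: v mn)
    then show ?thesis
      using pictures_eq_None_iff[OF p] pictures_eq_None_iff[OF p'] False v by (metis option.expand)
  qed
qed

lemma accepted_row_by_row_mem_iff: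
  assumes "L \<subseteq> pictures \<Sigma>" "ord_automaton B" "oa_alphabet B = \<Sigma>" "row_word ` L = oa_language B omega2"
    and p: "p \<in> pictures \<Sigma>"
  shows "p \<in> L \<longleftrightarrow> (\<exists>y. omega2_run B (\<lambda>n m. the (p (Suc m, Suc n))) y)"
proof -
  have "p \<in> L \<longleftrightarrow> row_word p \<in> row_word ` L"
    using inj_on_image_mem_iff[OF inj_on_row_word p assms(1)] by simp
  also have "\<dots> \<longleftrightarrow> oa_accepts B omega2 (row_word p)"
    using row_word_in_ord_words[OF p] assms(3,4) by (simp add: oa_language_def)
  finally show ?thesis
    by (simp add: oa_accepts_omega2_iff[OF assms(2)] row_word_apply)
qed

section \<open>From ordinal automata to tiling systems\<close>

text \<open>A cell \<open>(z, x, G, v)\<close> outside the border holds the state \<open>x\<close> of the ordinal automaton before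
  reading the letter and the set \<open>v\<close> of states met so far in the row; in column \<open>0\<close>, \<open>x\<close> is the
  limit state reached after the row and \<open>G\<close> the set of all states met in the row. The sets \<open>G\<close> are
  transported along antidiagonals to row \<open>0\<close> (marked by \<open>z\<close>), where the limit set at
  \<open>\<omega>\<^sup>2\<close> can be read off.\<close>

type_synonym 'q run_cell = "bool \<times> 'q \<times> 'q set \<times> 'q set"

text \<open>In column 0, \<open>x4 = x1\<close> starts each row from the limit state of the row
  below, or from the initial state at the origin. \<open>G2 = G3\<close> is the antidiagonal
  transport.\<close>

fun run_tile ::
  "('a, 'q) ord_automaton \<Rightarrow> ('a, 'q run_cell) cell \<Rightarrow> ('a, 'q run_cell) cell \<Rightarrow>
   ('a, 'q run_cell) cell \<Rightarrow> ('a, 'q run_cell) cell \<Rightarrow> bool" where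
  "run_tile B (a1, z1, x1, G1, v1) (a2, z2, x2, G2, v2) (a3, z3, x3, G3, v3) (a4, z4, x4, G4, v4) \<longleftrightarrow>
     z1 = (a2 = None) \<and> (a3 = None \<longrightarrow> v1 = {} \<and> x4 = x1) \<and> v2 = insert x2 v1 \<and> G2 = G3 \<and>
     (a1 \<noteq> None \<longrightarrow> (x1, the a1, x2) \<in> oa_trans B) \<and>
     (a2 = None \<longrightarrow> a3 = None \<longrightarrow> x1 = oa_init B)"

text \<open>By \<open>Union_inf_vals\<close> the unions collect the states lying in infinitely many
  of the sets. In row 0 these are the states met in infinitely many rows; in other rows, where
  \<open>v\<close> only grows, all states met, which makes the guess \<open>G\<close> exact.\<close>

fun run_row_cond :: "('a, 'q) ord_automaton \<Rightarrow> 'q run_cell \<Rightarrow> 'q run_cell set \<Rightarrow> bool" where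
  "run_row_cond B (z, x, G, v) I \<longleftrightarrow>
     (if z then \<exists>f \<in> oa_final B. (\<Union> ((\<lambda>(z, x, G, v). G) ` I), f) \<in> oa_limit B
      else ((\<lambda>(z, x, G, v). x) ` I, x) \<in> oa_limit B \<and> \<Union> ((\<lambda>(z, x, G, v). v) ` I) = G)"

lemma run_row_cond_inf_vals:
  assumes "finite (range (\<lambda>i. (zz i, xx i, GG i, vv i)))"
  shows "run_row_cond B (z, x, G, v) (inf_vals (\<lambda>i. (zz i, xx i, GG i, vv i))) \<longleftrightarrow>
     (if z then \<exists>f \<in> oa_final B. ({q. infinite {i. q \<in> GG i}}, f) \<in> oa_limit B
      else (inf_vals xx, x) \<in> oa_limit B \<and> {q. infinite {i. q \<in> vv i}} = G)"
proof -
  let ?f = "\<lambda>i. (zz i, xx i, GG i, vv i)"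
  have "finite (range GG)" "finite (range vv)"
    using finite_imageI[OF assms, of "\<lambda>(z, x, G, v). G"] finite_imageI[OF assms, of "\<lambda>(z, x, G, v). v"]
    by (simp_all add: image_image)
  then show ?thesis
    using inf_vals_comp[OF assms, of "\<lambda>(z, x, G, v). G"] inf_vals_comp[OF assms, of "\<lambda>(z, x, G, v). x"]
      inf_vals_comp[OF assms, of "\<lambda>(z, x, G, v). v"] Union_inf_vals[of GG] Union_inf_vals[of vv]
    by simp
qed

text \<open>A value once inserted stays forever. Starting from the empty set excludes
  \<open>x 0\<close>, which in a row is the limit state kept in column 0.\<close>

lemma infinite_mem_increasing:
  assumes "\<And>i. v (Suc i) = insert (x (Suc i)) (v i)" "v 0 = {}"
  shows "{q. infinite {i::nat. q \<in> v i}} = range (\<lambda>i. x (Suc i))"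
proof -
  have v: "v i = x ` {1..i}" for i
    by (induction i) (simp_all add: assms atLeastAtMostSuc_conv)
  have "(\<forall>m. \<exists>i>m. q \<in> v i) \<longleftrightarrow> (\<exists>i. q = x (Suc i))" for q
  proof
    assume "\<forall>m. \<exists>i>m. q \<in> v i"
    then obtain i where "q \<in> v i" by blast
    then obtain k where "k \<in> {1..i}" "q = x k" by (auto simp: v)
    then show "\<exists>i. q = x (Suc i)" by (intro exI[of _ "k - 1"]) auto
  next
    assume "\<exists>i. q = x (Suc i)"
    then obtain i where "q = x (Suc i)" by blast
    then show "\<forall>m. \<exists>i>m. q \<in> v i"
      by (intro allI, rule_tac x = "m + Suc i" in exI) (auto simp: v)
  qed
  then show ?thesis by (auto simp: infinite_nat_Collect_iff)
qed

lemma buchi_recognizable_if_accepted_row_by_row: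
  fixes \<Sigma> :: "'a set"
  assumes L: "L \<subseteq> pictures \<Sigma>" and "accepted_row_by_row \<Sigma> L"
  shows "buchi_recognizable \<Sigma> L"
proof -
  obtain B :: "('a, nat) ord_automaton" where B: "ord_automaton B" "oa_alphabet B = \<Sigma>"
    and LB: "row_word ` L = oa_language B omega2"
    using assms(2) by (auto simp: accepted_row_by_row_def regular_omega2_def)
  note mem_iff = accepted_row_by_row_mem_iff[OF L B LB]
  define Q where "Q = oa_states B"
  define C where "C = (UNIV :: bool set) \<times> Q \<times> Pow Q \<times> Pow Q"
  have fin: "finite \<Sigma>" "finite C"
    using B by (auto simp: ord_automaton_def C_def Q_def)
  have fin_row: "finite (range (\<lambda>i::nat. h i))" if "\<And>i. h i \<in> C" for h
    using that by (intro finite_subset[OF _ fin(2)]) auto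
  have "L = {p \<in> pictures \<Sigma>. \<exists>\<rho>. range \<rho> \<subseteq> C \<and> tiled (run_tile B) p \<rho> \<and>
       (\<forall>j. run_row_cond B (\<rho> (0, j)) (inf_vals (\<lambda>i. \<rho> (i, j))))}" (is "_ = ?R")
  proof (intro set_eqI iffI)
    fix p assume "p \<in> L"
    then have p: "p \<in> pictures \<Sigma>" using L by blast
    obtain y f where st: "\<And>n m. y n m \<in> Q" and init: "y 0 0 = oa_init B"
      and tr: "\<And>n m. (y n m, the (p (Suc m, Suc n)), y n (Suc m)) \<in> oa_trans B"
      and li: "\<And>n. (inf_vals (y n), y (Suc n) 0) \<in> oa_limit B"
      and f: "f \<in> oa_final B" "({q. infinite {n. q \<in> range (y n)}}, f) \<in> oa_limit B"
      using mem_iff[OF p] \<open>p \<in> L\<close> by (auto simp: omega2_run_def Q_def)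
    \<comment> \<open>Picture row \<open>j\<close> carries run row \<open>j - 1\<close>, so its
      limit state in column 0 is \<open>y j 0\<close>; at the origin this is the initial state,
      which also fills row 0.\<close>
    define x where "x i j = (if i = 0 \<or> j = 0 then y j 0 else y (j - 1) (i - 1))" for i j
    define v where "v i j = (\<lambda>k. x k j) ` {1..i}" for i j
    \<comment> \<open>\<open>G k\<close> labels the antidiagonal \<open>i + j = k\<close>; the
      origin has no run row and gets the default \<open>{}\<close>.\<close>
    define G where "G k = (case k of 0 \<Rightarrow> {} | Suc n \<Rightarrow> range (y n))" for k
    define \<rho> where "\<rho> = (\<lambda>(i, j). (j = (0::nat), x i j, G (i + j), v i j))"
    have v: "v (Suc i) j = insert (x (Suc i) j) (v i j)" "v 0 j = {}" for i j
      by (auto simp: v_def atLeastAtMostSuc_conv)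
    have \<rho>C: "\<rho> u \<in> C" for u
    proof -
      have "x i j \<in> Q" for i j using st by (simp add: x_def)
      moreover from this have "v i j \<subseteq> Q" for i j by (auto simp: v_def)
      moreover have "G k \<subseteq> Q" for k using st by (auto simp: G_def split: nat.splits)
      ultimately show ?thesis by (cases u) (simp add: \<rho>_def C_def)
    qed
    moreover have "tiled (run_tile B) p \<rho>"
    proof -
      have "(x i j, the (p (i, j)), x (Suc i) j) \<in> oa_trans B" if "i \<noteq> 0" "j \<noteq> 0" for i j
        using that tr[of "j - 1" "i - 1"] by (cases i; cases j) (auto simp: x_def)
      then show ?thesis
        unfolding tiled_def \<rho>_def
        by (simp add: pictures_eq_None_iff[OF p] v) (simp add: x_def init)
    qed
    moreover have "run_row_cond B (\<rho> (0, j)) (inf_vals (\<lambda>i. \<rho> (i, j)))" for j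
    proof -
      have *: "finite (range (\<lambda>i. (j = 0, x i j, G (i + j), v i j)))"
        using fin_row[of "\<lambda>i. \<rho> (i, j)", OF \<rho>C] by (simp add: \<rho>_def)
      show ?thesis
      proof (cases j)
        case 0
        have "infinite {i. q \<in> G i} \<longleftrightarrow> infinite {n. q \<in> range (y n)}" for q
          using infinite_Collect_Suc_iff[of "\<lambda>i. q \<in> G i"] by (simp add: G_def)
        then show ?thesis
          using f * by (auto simp: \<rho>_def run_row_cond_inf_vals 0 simp del: run_row_cond.simps)
      next
        case (Suc n)
        have "inf_vals (\<lambda>i. x i j) = inf_vals (y n)"
          using inf_vals_Suc[of "\<lambda>i. x i j"] by (simp add: x_def Suc)
        moreover have "{q. infinite {i. q \<in> v i j}} = range (y n)"
          using infinite_mem_increasing[of "\<lambda>i. v i j" "\<lambda>i. x i j"] v by (simp add: x_def Suc)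
        ultimately show ?thesis
          using * li[of n] by (simp add: \<rho>_def run_row_cond_inf_vals Suc del: run_row_cond.simps)
            (simp add: x_def G_def)
      qed
    qed
    ultimately show "p \<in> ?R" using p by blast
  next
    fix p assume "p \<in> ?R"
    then obtain \<rho> where p: "p \<in> pictures \<Sigma>" and \<rho>: "range \<rho> \<subseteq> C" "tiled (run_tile B) p \<rho>"
      "\<And>j. run_row_cond B (\<rho> (0, j)) (inf_vals (\<lambda>i. \<rho> (i, j)))" by auto
    define z where "z u = fst (\<rho> u)" for u
    define x where "x u = fst (snd (\<rho> u))" for u
    define G where "G u = fst (snd (snd (\<rho> u)))" for u
    define v where "v u = snd (snd (snd (\<rho> u)))" for u
    have \<rho>_eq: "\<rho> u = (z u, x u, G u, v u)" for u
      by (simp add: z_def x_def G_def v_def)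
    note tile = \<rho>(2)[unfolded tiled_def \<rho>_eq, simplified pictures_eq_None_iff[OF p] run_tile.simps]
    have z: "z (i, j) \<longleftrightarrow> j = 0" for i j using tile by auto
    have v: "v (Suc i, j) = insert (x (Suc i, j)) (v (i, j))" "v (0, j) = {}" for i j
      using tile by auto
    have x: "x (Suc 0, Suc j) = x (0, j)" "x (0, 0) = oa_init B" for j
      using tile by auto
    have xC: "x u \<in> Q" for u
      using \<rho>(1) by (force simp: \<rho>_eq C_def)
    have G: "G (i, j) = G (0, i + j)" for i j
    proof (induction i arbitrary: j)
      case (Suc i)
      have "G (Suc i, j) = G (i, Suc j)" using tile by auto
      then show ?case using Suc[of "Suc j"] by simp
    qed simp
    have *: "finite (range (\<lambda>i. (z (i, j), x (i, j), G (i, j), v (i, j))))" for j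
      by (rule fin_row) (use \<rho>(1) in \<open>auto simp flip: \<rho>_eq\<close>)
    note cond = \<rho>(3)[unfolded \<rho>_eq run_row_cond_inf_vals[OF *], unfolded z]
    define y where "y n m = x (Suc m, Suc n)" for n m
    have G_row: "G (0, Suc n) = range (y n)" for n
      using cond[of "Suc n"] infinite_mem_increasing[of "\<lambda>i. v (i, Suc n)" "\<lambda>i. x (i, Suc n)"] v
      by (simp add: y_def[abs_def])
    have "infinite {i. q \<in> G (i, 0)} \<longleftrightarrow> infinite {n. q \<in> range (y n)}" for q
      using infinite_Collect_Suc_iff[of "\<lambda>i. q \<in> G (i, 0)"] by (simp add: G[of "Suc _"] G_row)
    then have "\<exists>f \<in> oa_final B. ({q. infinite {n. q \<in> range (y n)}}, f) \<in> oa_limit B"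
      using cond[of 0] by simp
    moreover have "(inf_vals (y n), y (Suc n) 0) \<in> oa_limit B" for n
      using cond[of "Suc n"] inf_vals_Suc[of "\<lambda>i. x (i, Suc n)"] x by (simp add: y_def[abs_def])
    moreover have "(y n m, the (p (Suc m, Suc n)), y n (Suc m)) \<in> oa_trans B" for n m
      using tile by (simp add: y_def)
    ultimately have "omega2_run B (\<lambda>n m. the (p (Suc m, Suc n))) y"
      using xC x by (simp add: omega2_run_def y_def Q_def)
    then show "p \<in> L" using mem_iff[OF p] by blast
  qed
  then show ?thesis
    using buchi_recognizable_row_inf[OF fin] by simp
qed

section \<open>A recognizable language that is not accepted row by row\<close>

definition equal_rows :: "'a set \<Rightarrow> 'a picture set" where
  "equal_rows \<Sigma> = {p \<in> pictures \<Sigma>. \<forall>i j. p (Suc i, Suc (Suc j)) = p (Suc i, Suc j)}"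

lemma buchi_recognizable_equal_rows:
  assumes "finite \<Sigma>"
  shows "buchi_recognizable \<Sigma> (equal_rows \<Sigma>)"
proof -
  \<comment> \<open>Equality with the letter above is local, so one state suffices; it is final, and
    the grid is infinite.\<close>
  define T :: "('a, unit) cell \<Rightarrow> ('a, unit) cell \<Rightarrow> ('a, unit) cell \<Rightarrow> ('a, unit) cell \<Rightarrow> bool" where
    "T = (\<lambda>c1 c2 c3 c4. fst c1 \<noteq> None \<longrightarrow> fst c3 = fst c1)"
  have eq: "tiled T p \<rho> \<longleftrightarrow> (\<forall>i j. p (Suc i, Suc (Suc j)) = p (Suc i, Suc j))"
    if "p \<in> pictures \<Sigma>" for p \<rho>
    unfolding tiled_def T_def using pictures_eq_None_iff[OF that]
    by (auto simp: gr0_conv_Suc)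
  have "equal_rows \<Sigma> = {p \<in> pictures \<Sigma>. \<exists>\<rho>. range \<rho> \<subseteq> UNIV \<and> tiled T p \<rho> \<and>
      infinite {v. \<rho> v \<in> (UNIV :: unit set)}}"
    by (auto simp: equal_rows_def eq finite_prod)
  then show ?thesis
    using buchi_recognizable_tiled[OF assms, of UNIV T UNIV] by simp
qed

text \<open>Only the state \<open>y 1 0\<close> links row 0 to the later rows, and the limit set at
  \<omega> squared does not change when one row is replaced.\<close>

lemma omega2_run_splice:
  assumes y: "omega2_run B w y" and y': "omega2_run B w' y'" and eq: "y 1 0 = y' 1 0"
  shows "omega2_run B (w'(0 := w 0)) (y'(0 := y 0))"
proof -
  have "(inf_vals (y 0), y' 1 0) \<in> oa_limit B"
    using y eq unfolding omega2_run_def by (metis One_nat_def)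
  moreover have inf: "infinite {n. q \<in> range ((y'(0 := y 0)) n)} \<longleftrightarrow> infinite {n. q \<in> range (y' n)}" for q
    unfolding infinite_nat_Collect_iff by (metis fun_upd_other gr_implies_not0)
  ultimately show ?thesis
    using assms unfolding omega2_run_def inf by auto
qed

lemma not_accepted_row_by_row_equal_rows:
  "\<not> accepted_row_by_row {0, 1 :: nat} (equal_rows {0, 1})"
proof
  let ?\<Sigma> = "{0, 1 :: nat}"
  assume "accepted_row_by_row ?\<Sigma> (equal_rows ?\<Sigma>)"
  then obtain B :: "(nat, nat) ord_automaton" where B: "ord_automaton B" "oa_alphabet B = ?\<Sigma>"
    and LB: "row_word ` equal_rows ?\<Sigma> = oa_language B omega2"
    by (auto simp: accepted_row_by_row_def regular_omega2_def)
  have "equal_rows ?\<Sigma> \<subseteq> pictures ?\<Sigma>" by (auto simp: equal_rows_def)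
  note mem_iff = accepted_row_by_row_mem_iff[OF this B LB]
  define pic :: "(nat \<Rightarrow> nat \<Rightarrow> nat) \<Rightarrow> nat picture" where
    "pic w = (\<lambda>(i, j). if i = 0 \<or> j = 0 then None else Some (w (j - 1) (i - 1)))" for w
  \<comment> \<open>Every row of \<open>w k\<close> has its only 1 at position \<open>k\<close>:
    infinitely many pictures compete for finitely many states after the first row.\<close>
  define w :: "nat \<Rightarrow> nat \<Rightarrow> nat \<Rightarrow> nat" where "w k n m = (if m = k then 1 else 0)" for k n m
  have pic: "pic u \<in> pictures ?\<Sigma>" if "\<And>n m. u n m \<in> ?\<Sigma>" for u
    using that by (auto simp: pic_def pictures_def)
  have pic_run: "pic u \<in> equal_rows ?\<Sigma> \<longleftrightarrow> (\<exists>y. omega2_run B u y)" if "\<And>n m. u n m \<in> ?\<Sigma>" for u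
    using mem_iff[OF pic[OF that]] by (simp add: pic_def)
  have w: "w k n m \<in> ?\<Sigma>" for k n m by (simp add: w_def)
  have "pic (w k) \<in> equal_rows ?\<Sigma>" for k
  proof -
    have "pic (w k) (Suc i, Suc (Suc j)) = pic (w k) (Suc i, Suc j)" for i j
      by (simp add: pic_def w_def)
    then show ?thesis using pic[OF w] by (simp add: equal_rows_def)
  qed
  then have "\<exists>y. omega2_run B (w k) y" for k
    using pic_run[of "w k" for k, OF w] by blast
  then obtain y where y: "\<And>k. omega2_run B (w k) (y k)" by metis
  have "range (\<lambda>k. y k 1 0) \<subseteq> oa_states B"
    using y by (auto simp: omega2_run_def)
  then have "finite (range (\<lambda>k. y k 1 0))"
    using B(1) finite_subset by (auto simp: ord_automaton_def)
  then have "\<not> inj (\<lambda>k. y k 1 0)" using finite_imageD by blast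
  then obtain k k' where k: "y k 1 0 = y k' 1 0" "k \<noteq> k'" by (auto simp: inj_on_def)
  \<comment> \<open>The first row has its 1 at \<open>k\<close>, all others at \<open>k'\<close>, so
    the rows differ in picture column \<open>Suc k\<close>.\<close>
  let ?u = "(w k')(0 := w k 0)"
  have "?u n m \<in> ?\<Sigma>" for n m by (simp add: w_def)
  then have "pic ?u \<in> equal_rows ?\<Sigma>"
    using pic_run omega2_run_splice[OF y y k(1)] by blast
  then have "pic ?u (Suc k, Suc (Suc 0)) = pic ?u (Suc k, Suc 0)"
    by (auto simp: equal_rows_def)
  then show False using k(2) by (simp add: pic_def w_def)
qed

theorem theorem4p1:
  "(\<forall>(\<Sigma> :: 'a set) L. finite \<Sigma> \<longrightarrow> L \<subseteq> pictures \<Sigma> \<longrightarrow>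
      accepted_row_by_row \<Sigma> L \<longrightarrow> buchi_recognizable \<Sigma> L) \<and>
   (\<exists>(\<Sigma> :: nat set) L. finite \<Sigma> \<and> L \<subseteq> pictures \<Sigma> \<and>
      buchi_recognizable \<Sigma> L \<and> \<not> accepted_row_by_row \<Sigma> L)"
proof (intro conjI allI impI)
  fix \<Sigma> :: "'a set" and L
  assume "L \<subseteq> pictures \<Sigma>" "accepted_row_by_row \<Sigma> L"
  then show "buchi_recognizable \<Sigma> L"
    by (rule buchi_recognizable_if_accepted_row_by_row)
next
  show "\<exists>(\<Sigma> :: nat set) L. finite \<Sigma> \<and> L \<subseteq> pictures \<Sigma> \<and>
      buchi_recognizable \<Sigma> L \<and> \<not> accepted_row_by_row \<Sigma> L"
    using buchi_recognizable_equal_rows[of "{0, 1 :: nat}"] not_accepted_row_by_row_equal_rows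
    by (intro exI[of _ "{0, 1}"] exI[of _ "equal_rows {0, 1}"]) (auto simp: equal_rows_def)
qed

end
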